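(* There is an isometry $g\in\mathrm{Aut}(\mathbb{U})$ such that the $\langle g\rangle$-orbit $\{g^n x : n\in\mathbb{Z}\}$ of some point $x\in\mathbb{U}$ is dense in $\mathbb{U}$. Moreover, whenever $g\in\mathrm{Aut}(\mathbb{U})$ has this property, the $\langle g\rangle$-orbit of each point of $\mathbb{U}$ is dense in $\mathbb{U}$.
   Context: $\mathbb{U}$ denotes the Urysohn space: the complete separable metric space, unique up to isometry, that is homogeneous (any isometry between finite subsets extends to an isometry of $\mathbb{U}$ onto itself) and universal (every complete separable metric space embeds isometrically in it). $\mathrm{Aut}(\mathbb{U})$ is the group of all isometries of $\mathbb{U}$ onto itself. *)

theory Defs
  imports "HOL-Analysis.Analysis" "HOL-Algebra.Bij"
begin

definition isometric_embedding :: "'a metric \<Rightarrow> 'b metric \<Rightarrow> ('a \<Rightarrow> 'b) \<Rightarrow> bool" where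
  "isometric_embedding X Y f \<longleftrightarrow>
     f \<in> mspace X \<rightarrow> mspace Y \<and>
     (\<forall>x\<in>mspace X. \<forall>y\<in>mspace X. mdist Y (f x) (f y) = mdist X x y)"

definition isometry :: "'a metric \<Rightarrow> 'b metric \<Rightarrow> ('a \<Rightarrow> 'b) \<Rightarrow> bool" where
  "isometry X Y f \<longleftrightarrow> isometric_embedding X Y f \<and> f ` mspace X = mspace Y"

definition polish_metric :: "'a metric \<Rightarrow> bool" where
  "polish_metric X \<longleftrightarrow>
     Metric_space.mcomplete (mspace X) (mdist X) \<and> separable_space (mtopology_of X)"

text \<open>The elements of \<^term>\<open>BijGroup S\<close> are extensional functions, so self-isometries
  are identified here when they agree on the points of the space.\<close>

definition Aut :: "'a metric \<Rightarrow> ('a \<Rightarrow> 'a) monoid" where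
  "Aut X = (BijGroup (mspace X))\<lparr>carrier := {g \<in> Bij (mspace X). isometry X X g}\<rparr>"

definition metric_homogeneous :: "'a metric \<Rightarrow> bool" where
  "metric_homogeneous X \<longleftrightarrow>
     (\<forall>A B f. finite A \<and> finite B \<and> A \<subseteq> mspace X \<and> B \<subseteq> mspace X \<and>
        isometry (submetric X A) (submetric X B) f \<longrightarrow>
        (\<exists>g\<in>carrier (Aut X). \<forall>x\<in>A. g x = f x))"

text \<open>A definition cannot quantify over all types.  A separable metric space has at most
  continuum many points, so it is isometric to one whose carrier is a set of reals, and
  quantifying over the latter loses nothing: see \<open>universal_embeds\<close> below.\<close>

definition metric_universal :: "'a metric \<Rightarrow> bool" where
  "metric_universal X \<longleftrightarrow>
     (\<forall>Y :: real metric. polish_metric Y \<longrightarrow> (\<exists>f. isometric_embedding Y X f))"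

definition urysohn_space :: "'a metric \<Rightarrow> bool" where
  "urysohn_space X \<longleftrightarrow> polish_metric X \<and> metric_homogeneous X \<and> metric_universal X"

definition cyclic_orbit :: "'a metric \<Rightarrow> ('a \<Rightarrow> 'a) \<Rightarrow> 'a \<Rightarrow> 'a set" where
  "cyclic_orbit X g x = {(g [^]\<^bsub>Aut X\<^esub> n) x | n :: int. True}"

definition dense_in_metric :: "'a metric \<Rightarrow> 'a set \<Rightarrow> bool" where
  "dense_in_metric X S \<longleftrightarrow> S \<subseteq> mspace X \<and> mtopology_of X closure_of S = mspace X"

lemma subgroup_Aut: "subgroup (carrier (Aut X)) (BijGroup (mspace X))"
proof (rule group.subgroupI [OF group_BijGroup])
  let ?S = "mspace X" and ?A = "carrier (Aut X)"
  have A: "g \<in> ?A \<longleftrightarrow> g \<in> Bij ?S \<and> (\<forall>x\<in>?S. \<forall>y\<in>?S. mdist X (g x) (g y) = mdist X x y)" for g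
    by (auto simp: Aut_def isometry_def isometric_embedding_def Bij_def bij_betw_def)
  show "?A \<subseteq> carrier (BijGroup ?S)"
    by (auto simp: Aut_def BijGroup_def)
  have "(\<lambda>x\<in>?S. x) \<in> ?A"
    by (simp add: A id_Bij)
  then show "?A \<noteq> {}"
    by blast
  fix g assume g: "g \<in> ?A"
  then have gB: "g \<in> Bij ?S" and gd: "\<And>x y. x \<in> ?S \<Longrightarrow> y \<in> ?S \<Longrightarrow> mdist X (g x) (g y) = mdist X x y"
    by (auto simp: A)
  show "inv\<^bsub>BijGroup ?S\<^esub> g \<in> ?A"
  proof -
    have "mdist X (inv_into ?S g x) (inv_into ?S g y) = mdist X x y" if "x \<in> ?S" "y \<in> ?S" for x y
    proof -
      have "g (inv_into ?S g z) = z" if "z \<in> ?S" for z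
        using gB that by (auto simp: Bij_def bij_betw_def f_inv_into_f)
      with gd [of "inv_into ?S g x" "inv_into ?S g y"] that gB show ?thesis
        by (simp add: Bij_inv_into_mem)
    qed
    then show ?thesis
      using gB by (simp add: A inv_BijGroup restrict_inv_into_Bij)
  qed
  fix h assume h: "h \<in> ?A"
  then have hB: "h \<in> Bij ?S" and "\<And>x y. x \<in> ?S \<Longrightarrow> y \<in> ?S \<Longrightarrow> mdist X (h x) (h y) = mdist X x y"
    by (auto simp: A)
  moreover have "h x \<in> ?S" if "x \<in> ?S" for x
    using Bij_imp_funcset [OF hB] that by blast
  ultimately show "g \<otimes>\<^bsub>BijGroup ?S\<^esub> h \<in> ?A"
    using gB gd by (simp add: A BijGroup_def compose_Bij compose_eq)
qed

lemma group_Aut: "group (Aut X)"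
proof -
  have "Aut X = (BijGroup (mspace X))\<lparr>carrier := carrier (Aut X)\<rparr>"
    by (simp add: Aut_def)
  then show ?thesis
    using subgroup.subgroup_is_group [OF subgroup_Aut group_BijGroup, of X] by simp
qed

lemma separable_metric_lepoll_reals:
  assumes "separable_space (mtopology_of X)"
  shows "mspace X \<lesssim> (UNIV :: real set)"
proof -
  interpret Metric_space "mspace X" "mdist X"
    by simp
  obtain C where C: "countable C" "C \<subseteq> mspace X" "mtopology closure_of C = mspace X"
    using assms by (auto simp: separable_space_def mtopology_of_def)
  define h where "h x = to_nat_on (C \<times> \<rat>) ` {(c, q). c \<in> C \<and> q \<in> \<rat> \<and> mdist X x c < q}" for x
  have cnt: "countable (C \<times> (\<rat> :: real set))"
    using C(1) countable_rat by blast
  have "inj_on h (mspace X)"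
  proof (rule inj_onI, rule ccontr)
    fix x y assume xy: "x \<in> mspace X" "y \<in> mspace X" "h x = h y" "x \<noteq> y"
    have eq: "{(c, q). c \<in> C \<and> q \<in> \<rat> \<and> mdist X x c < q} = {(c, q). c \<in> C \<and> q \<in> \<rat> \<and> mdist X y c < q}"
      using xy(3) unfolding h_def
      by (subst (asm) inj_on_image_eq_iff [OF inj_on_to_nat_on [OF cnt]]) auto
    let ?d = "mdist X x y"
    have "?d > 0"
      using xy by simp
    moreover have "\<forall>r>0. \<exists>c\<in>C. mdist X x c < r"
      using C(3) xy(1) unfolding metric_closure_of by fastforce
    ultimately obtain c where c: "c \<in> C" "mdist X x c < ?d / 2"
      using half_gt_zero by blast
    obtain q where q: "q \<in> \<rat>" "mdist X x c < q" "q < ?d / 2"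
      using Rats_dense_in_real c(2) by blast
    with c(1) eq have "mdist X y c < q"
      by blast
    moreover have "?d \<le> mdist X x c + mdist X y c"
      using triangle'' [of x c y] c(1) C(2) xy by (simp add: triangle subsetD commute)
    ultimately show False
      using q by linarith
  qed
  then have "mspace X \<lesssim> (UNIV :: nat set set)"
    by (auto simp: lepoll_def)
  then show ?thesis
    using nat_sets_eqpoll_reals lepoll_trans2 by blast
qed

lemma universal_embeds:
  fixes X :: "'a metric" and Y :: "'b metric"
  assumes "metric_universal X" and Y: "polish_metric Y"
  shows "\<exists>f. isometric_embedding Y X f"
proof -
  obtain e :: "'b \<Rightarrow> real" where e: "inj_on e (mspace Y)"
    using separable_metric_lepoll_reals Y by (auto simp: polish_metric_def lepoll_def)
  define k where "k = inv_into (mspace Y) e"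
  have k: "k (e y) = y" if "y \<in> mspace Y" for y
    using e that by (simp add: k_def)
  interpret Y: Metric_space "mspace Y" "mdist Y"
    by simp
  define Z where "Z = metric (e ` mspace Y, \<lambda>u v. mdist Y (k u) (k v))"
  have "Metric_space (e ` mspace Y) (\<lambda>u v. mdist Y (k u) (k v))"
    by unfold_locales (auto simp: k Y.commute Y.triangle)
  then have Z: "mspace Z = e ` mspace Y" "mdist Z = (\<lambda>u v. mdist Y (k u) (k v))"
    by (simp_all add: Z_def Metric_space.mspace_metric Metric_space.mdist_metric)
  interpret YZ: Metric_space12 "mspace Y" "mdist Y" "mspace Z" "mdist Z"
    by (simp add: Metric_space12_def)
  have hom: "homeomorphic_map (mtopology_of Y) (mtopology_of Z) e"
    unfolding mtopology_of_def
    by (rule YZ.isometry_imp_homeomorphic_map) (auto simp: Z k)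
  have "separable_space (mtopology_of Z)"
    using hom Y homeomorphic_separable_space homeomorphic_map_imp_homeomorphic_space
    unfolding polish_metric_def by blast
  moreover have "YZ.M2.mcomplete"
    unfolding YZ.M2.mcomplete_def
  proof (intro allI impI)
    fix s assume s: "YZ.M2.MCauchy s"
    then have rng: "range s \<subseteq> e ` mspace Y"
      unfolding YZ.M2.MCauchy_def by (simp add: Z)
    have kin: "k (s n) \<in> mspace Y" for n
    proof -
      obtain y where "y \<in> mspace Y" "s n = e y"
        using rng by blast
      then show ?thesis
        by (simp add: k)
    qed
    have "Y.MCauchy (\<lambda>n. k (s n))"
      using s kin unfolding YZ.M2.MCauchy_def Y.MCauchy_def by (auto simp: Z)
    then obtain l where "limitin Y.mtopology (\<lambda>n. k (s n)) l sequentially"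
      using Y by (auto simp: polish_metric_def Y.mcomplete_def)
    then have "limitin YZ.M2.mtopology s (e l) sequentially"
      using rng unfolding Y.limitin_metric YZ.M2.limitin_metric by (auto simp: Z k range_subsetD kin)
    then show "\<exists>l. limitin YZ.M2.mtopology s l sequentially"
      by blast
  qed
  ultimately obtain f where "isometric_embedding Z X f"
    using assms(1) by (auto simp: metric_universal_def polish_metric_def)
  then have "isometric_embedding Y X (f \<circ> e)"
    by (auto simp: isometric_embedding_def Z k)
  then show ?thesis
    by blast
qed

end

theory Submission
  imports Defs
begin

text \<open>
  It suffices to find a dense sequence \<open>z\<close> in \<open>U\<close> whose distances \<open>d (z i) (z j)\<close> depend only on
  \<open>\<bar>i - j\<bar>\<close>: the shift \<open>z n \<mapsto> z (n + 1)\<close> then extends to an isometry of \<open>U\<close>, which is onto because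
  \<open>U\<close> has no isolated points, so that \<open>z 1, z 2, \<dots>\<close> is still dense.  The sequence is built in finite
  stages.  Given \<open>z 0, \<dots>, z L\<close> and a point \<open>u\<close> to be visited, one looks for a shift-invariant metric on
  \<open>{0..M}\<close>, with \<open>M\<close> large, which agrees with the given one on \<open>{0..L}\<close> and gives \<open>M\<close> the distances of
  \<open>u\<close> to \<open>z 0, \<dots>, z L\<close>; universality and homogeneity realise it in \<open>U\<close> with \<open>z M = u\<close>.  Every orbit
  is dense as soon as one is because \<open>g\<close> preserves distances: if \<open>g\<^sup>n x\<close> is near \<open>y\<close> and \<open>g\<^sup>m x\<close> is near
  \<open>w\<close>, then \<open>g\<close> to the power \<open>m - n\<close> sends \<open>y\<close> near \<open>w\<close>.
\<close>

section \<open>Shift-invariant metrics on initial segments of the natural numbers\<close>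

text \<open>The absolute difference: one of the two truncated differences is always 0.\<close>

definition ndist :: "nat \<Rightarrow> nat \<Rightarrow> nat" where
  "ndist i j = (i - j) + (j - i)"

text \<open>Only \<^term>\<open>f\<close> on \<^term>\<open>{..L}\<close> matters: \<^term>\<open>\<lambda>i j. f (ndist i j)\<close> is a metric there.\<close>

definition toeplitz :: "nat \<Rightarrow> (nat \<Rightarrow> real) \<Rightarrow> bool" where
  "toeplitz L f \<longleftrightarrow> f 0 = 0 \<and> (\<forall>i. 0 < i \<and> i \<le> L \<longrightarrow> 0 < f i) \<and>
     (\<forall>a b. a + b \<le> L \<longrightarrow> f (a + b) \<le> f a + f b \<and> f a \<le> f b + f (a + b))"

text \<open>Among the three differences of three indices, one is the sum of the other two. The
  definition of \<open>toeplitz\<close> covers every inequality for such a triple, after exchanging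
  \<open>a\<close> and \<open>b\<close> if necessary.\<close>

lemma toeplitz_triangle:
  assumes "toeplitz L f" "ndist i j \<le> L" "ndist j k \<le> L" "ndist i k \<le> L"
  shows "f (ndist i k) \<le> f (ndist i j) + f (ndist j k)"
proof -
  have *: "f c \<le> f a + f b \<and> f a \<le> f b + f c \<and> f b \<le> f a + f c" if "c = a + b" "c \<le> L" for a b c
    using assms(1) that unfolding toeplitz_def by (metis add.commute)
  have "ndist i k = ndist i j + ndist j k \<or> ndist i j = ndist i k + ndist j k
      \<or> ndist j k = ndist i j + ndist i k"
    unfolding ndist_def by arith
  with *[of "ndist i k"] *[of "ndist i j"] *[of "ndist j k"] assms(2-) show ?thesis
    by (smt (verit))
qed

lemma ndist_simps [simp]: "ndist i i = 0" "ndist 0 i = i" "ndist i 0 = i"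
  "ndist (Suc i) (Suc j) = ndist i j"
  by (auto simp: ndist_def)

lemma ndist_commute: "ndist i j = ndist j i"
  by (simp add: ndist_def)

lemma ndist_le: "i \<le> L \<Longrightarrow> j \<le> L \<Longrightarrow> ndist i j \<le> L"
  by (auto simp: ndist_def)

lemma ndist_pos: "i \<noteq> j \<Longrightarrow> 0 < ndist i j"
  by (auto simp: ndist_def)

text \<open>The default value 0 is there because \<open>Metric_space\<close> demands nonnegativity
  for all arguments, also those outside the carrier, and \<open>f\<close> is unconstrained beyond
  \<open>L\<close>.\<close>

lemma toeplitz_Metric_space:
  assumes f: "toeplitz L f"
  shows "Metric_space {..L} (\<lambda>i j. if i \<le> L \<and> j \<le> L then f (ndist i j) else 0)"
proof
  fix i j k :: nat
  have nonneg: "0 \<le> f n" if "n \<le> L" for n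
    using f that unfolding toeplitz_def by (cases "n = 0") (auto intro: less_imp_le)
  show "0 \<le> (if i \<le> L \<and> j \<le> L then f (ndist i j) else 0)"
    by (auto intro: nonneg ndist_le)
  show "(if i \<le> L \<and> j \<le> L then f (ndist i j) else 0) = (if j \<le> L \<and> i \<le> L then f (ndist j i) else 0)"
    by (simp add: ndist_commute)
  assume i: "i \<in> {..L}" and j: "j \<in> {..L}"
  show "(if i \<le> L \<and> j \<le> L then f (ndist i j) else 0) = 0 \<longleftrightarrow> i = j"
  proof (cases "i = j")
    case True
    then show ?thesis using f by (simp add: toeplitz_def)
  next
    case False
    then have "0 < f (ndist i j)"
      using f i j ndist_le ndist_pos unfolding toeplitz_def by simp
    then show ?thesis using i j False by simp
  qed
  assume k: "k \<in> {..L}"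
  show "(if i \<le> L \<and> k \<le> L then f (ndist i k) else 0)
    \<le> (if i \<le> L \<and> j \<le> L then f (ndist i j) else 0) + (if j \<le> L \<and> k \<le> L then f (ndist j k) else 0)"
    using toeplitz_triangle[OF f, of i j k] i j k by (simp add: ndist_le)
qed

text \<open>The new value is the distance in the amalgam of \<open>{0..L}\<close> and \<open>{1..L + 1}\<close>, truncated at \<open>C\<close>.
  The linear lower bound is preserved and forces the value \<open>C\<close> at all large arguments.\<close>

lemma toeplitz_Suc:
  assumes f: "toeplitz L f" and C: "\<And>i. i \<le> L \<Longrightarrow> f i \<le> C" "0 < C"
    and low: "\<And>i. i \<le> L \<Longrightarrow> min C (\<delta> * real i) \<le> f i"
  shows "\<exists>m. toeplitz (Suc L) (f(Suc L := m)) \<and> m \<le> C \<and> min C (\<delta> * real (Suc L)) \<le> m"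
proof -
  define A where "A = insert C ((\<lambda>i. f i + f (Suc L - i)) ` {1..L})"
  define m where "m = Min A"
  have fin: "finite A" "A \<noteq> {}" by (auto simp: A_def)
  have le: "m \<le> C" "\<And>i. 1 \<le> i \<Longrightarrow> i \<le> L \<Longrightarrow> m \<le> f i + f (Suc L - i)"
    unfolding m_def by (rule Min_le[OF fin(1)], force simp: A_def)+
  have "m \<in> A"
    unfolding m_def using fin by (rule Min_in)
  then have m: "m = C \<or> (\<exists>i. 1 \<le> i \<and> i \<le> L \<and> m = f i + f (Suc L - i))"
    by (auto simp: A_def)
  have pos: "0 < f i" if "1 \<le> i" "i \<le> L" for i
    using f that by (auto simp: toeplitz_def)
  have f0: "f 0 = 0" using f by (simp add: toeplitz_def)
  have mpos: "0 < m"
    using m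
  proof
    assume "\<exists>i. 1 \<le> i \<and> i \<le> L \<and> m = f i + f (Suc L - i)"
    then obtain i where i: "1 \<le> i" "i \<le> L" "m = f i + f (Suc L - i)" by blast
    then have "1 \<le> Suc L - i" "Suc L - i \<le> L" by linarith+
    then show ?thesis using pos[of i] pos[of "Suc L - i"] i by linarith
  qed (use C in simp)
  have shrink: "f a \<le> f b + m" if ab: "a + b = Suc L" "1 \<le> a" "1 \<le> b" for a b
    using m
  proof
    assume "m = C"
    then show ?thesis
      using C(1)[of a] pos[of b] ab by simp
  next
    assume "\<exists>i. 1 \<le> i \<and> i \<le> L \<and> m = f i + f (Suc L - i)"
    then obtain i where i: "1 \<le> i" "i \<le> L" "m = f i + f (Suc L - i)" by blast
    \<comment> \<open>The points \<open>b\<close>, \<open>i\<close> and \<open>Suc L\<close> lie in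
      the translate {1..Suc L}, whose differences are at most \<open>L\<close>, so the old
      inequalities apply. A detour from \<open>b\<close> to \<open>i\<close> through 0 then brings
      in \<open>f b + f i\<close>.\<close>
    have "f (ndist b (Suc L)) \<le> f (ndist b i) + f (ndist i (Suc L))"
      by (rule toeplitz_triangle[OF f]) (use ab i in \<open>auto simp: ndist_def\<close>)
    moreover have "f (ndist b i) \<le> f (ndist b 0) + f (ndist 0 i)"
      by (rule toeplitz_triangle[OF f]) (use ab i in \<open>auto simp: ndist_def\<close>)
    moreover have "ndist b (Suc L) = a" "ndist i (Suc L) = Suc L - i"
      using ab i by (auto simp: ndist_def)
    ultimately show ?thesis
      using i(3) by simp
  qed
  have "toeplitz (Suc L) (f(Suc L := m))"
    unfolding toeplitz_def
  proof (intro conjI allI impI)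
    show "(f(Suc L := m)) 0 = 0" using f0 by simp
    show "0 < (f(Suc L := m)) i" if "0 < i \<and> i \<le> Suc L" for i
      using that pos[of i] mpos by (cases "i = Suc L") auto
    fix a b assume ab: "a + b \<le> Suc L"
    let ?f = "f(Suc L := m)"
    have "?f (a + b) \<le> ?f a + ?f b \<and> ?f a \<le> ?f b + ?f (a + b)"
    proof (cases "a + b = Suc L")
      case False
      then show ?thesis using f ab by (auto simp: toeplitz_def)
    next
      case ab: True
      show ?thesis
      proof (cases "a = 0 \<or> b = 0")
        case True
        then show ?thesis using ab f0 mpos by auto
      next
        case False
        then have "b = Suc L - a" "1 \<le> a" "a \<le> L" "1 \<le> b" "b \<le> L" using ab by auto
        then show ?thesis using shrink[of a b] le(2)[of a] ab by auto
      qed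
    qed
    then show "?f (a + b) \<le> ?f a + ?f b" "?f a \<le> ?f b + ?f (a + b)" by auto
  qed
  \<comment> \<open>If both summands of \<open>m\<close> exceed their linear bounds, these bounds
    add up. If one summand has reached \<open>C\<close>, positivity of the other suffices.\<close>
  moreover have "min C (\<delta> * real (Suc L)) \<le> m"
    using m
  proof
    assume "\<exists>i. 1 \<le> i \<and> i \<le> L \<and> m = f i + f (Suc L - i)"
    then obtain i where i: "1 \<le> i" "i \<le> L" "m = f i + f (Suc L - i)" by blast
    have "\<delta> * real (Suc L) = \<delta> * real i + \<delta> * real (Suc L - i)"
      using i by (simp add: of_nat_diff algebra_simps)
    moreover have "1 \<le> Suc L - i" "Suc L - i \<le> L" using i by linarith+
    ultimately show ?thesis
      using low[of i] low[of "Suc L - i"] pos[of i] pos[of "Suc L - i"] i unfolding min_def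
      by (smt (verit))
  qed auto
  ultimately show ?thesis
    using le(1) by blast
qed

lemma toeplitz_extend:
  assumes f: "toeplitz L f" and C: "\<And>i. i \<le> L \<Longrightarrow> f i \<le> C" "0 < C"
    and low: "\<And>i. i \<le> L \<Longrightarrow> min C (\<delta> * real i) \<le> f i"
  shows "\<exists>F. toeplitz (L + K) F \<and> (\<forall>i\<le>L. F i = f i) \<and>
    (\<forall>i\<le>L + K. F i \<le> C \<and> min C (\<delta> * real i) \<le> F i)"
proof (induction K)
  case 0
  then show ?case using assms by auto
next
  case (Suc K)
  then obtain F where F: "toeplitz (L + K) F" "\<And>i. i \<le> L \<Longrightarrow> F i = f i"
      "\<And>i. i \<le> L + K \<Longrightarrow> F i \<le> C" "\<And>i. i \<le> L + K \<Longrightarrow> min C (\<delta> * real i) \<le> F i"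
    by auto
  obtain m where m: "toeplitz (Suc (L + K)) (F(Suc (L + K) := m))" "m \<le> C"
      "min C (\<delta> * real (Suc (L + K))) \<le> m"
    using toeplitz_Suc[OF F(1,3) C(2) F(4)] by blast
  let ?F = "F(Suc (L + K) := m)"
  have "?F i \<le> C \<and> min C (\<delta> * real i) \<le> ?F i" if "i \<le> Suc (L + K)" for i
    using that F(3,4)[of i] m(2,3) by (cases "i = Suc (L + K)") simp_all
  moreover have "?F i = f i" if "i \<le> L" for i
    using F(2) that by simp
  ultimately show ?case
    using m(1) unfolding add_Suc_right by blast
qed

text \<open>Finitely many positive ratios \<open>f i / real i\<close> have a positive minimum, which
  serves as the slope. The parameter \<open>c\<close> lets \<open>C\<close> dominate further data,
  such as the distances to the point to be visited.\<close>

lemma toeplitz_bounds: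
  assumes f: "toeplitz L f"
  shows "\<exists>C \<delta>. 0 < \<delta> \<and> c \<le> C \<and> 0 < C \<and> (\<forall>i\<le>L. f i \<le> C \<and> \<delta> * real i \<le> f i)"
proof (intro exI conjI allI impI)
  define D where "D = insert 1 ((\<lambda>i. f i / real i) ` {1..L})"
  have fin: "finite D" "D \<noteq> {}" by (auto simp: D_def)
  show "0 < Min D"
    using fin f by (auto simp: D_def toeplitz_def)
  let ?E = "insert c (insert 1 (f ` {..L}))"
  show "c \<le> Max ?E" by (rule Max_ge) auto
  have "1 \<le> Max ?E" by (rule Max_ge) auto
  then show "0 < Max ?E" by linarith
  fix i assume i: "i \<le> L"
  show "f i \<le> Max ?E" by (rule Max_ge) (use i in auto)
  show "Min D * real i \<le> f i"
  proof (cases "i = 0")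
    case True
    then show ?thesis using f by (simp add: toeplitz_def)
  next
    case False
    have "Min D \<le> f i / real i"
      by (rule Min_le) (use i False fin in \<open>auto simp: D_def\<close>)
    then show ?thesis using False by (simp add: field_simps)
  qed
qed

text \<open>Extend \<open>f\<close> to \<open>F\<close>, and the distances \<open>g\<close> to the Katetov function \<open>G\<close> over \<open>F\<close>, both truncated
  at \<open>C\<close>.  Both are constantly \<open>C\<close> far out, so for \<open>M\<close> large the functions \<open>F n\<close> and \<open>G (M - n)\<close>
  can be glued along a middle range where they equal \<open>C\<close>.\<close>

lemma toeplitz_realize:
  assumes f: "toeplitz L f" and gpos: "\<And>i. i \<le> L \<Longrightarrow> 0 < g i"
    and g1: "\<And>i j. i \<le> L \<Longrightarrow> j \<le> L \<Longrightarrow> g i \<le> g j + f (ndist i j)"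
    and g2: "\<And>i j. i \<le> L \<Longrightarrow> j \<le> L \<Longrightarrow> f (ndist i j) \<le> g i + g j"
  shows "\<exists>M f'. L < M \<and> toeplitz M f' \<and> (\<forall>i\<le>L. f' i = f i \<and> f' (M - i) = g i)"
proof -
  obtain C \<delta> where \<delta>: "0 < \<delta>" and C: "Max (g ` {..L}) \<le> C" "0 < C" "\<And>i. i \<le> L \<Longrightarrow> f i \<le> C"
    and low: "\<And>i. i \<le> L \<Longrightarrow> \<delta> * real i \<le> f i"
    using toeplitz_bounds[OF f, of "Max (g ` {..L})"] by blast
  have gC: "g i \<le> C" if "i \<le> L" for i
    using C(1) that by (meson Max_ge atMost_iff finite_atMost finite_imageI imageI order_trans)
  obtain N0 :: nat where "C / \<delta> \<le> real N0"
    using real_arch_simple by blast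
  then have N0: "C \<le> \<delta> * real N0"
    using \<delta> by (simp add: field_simps)
  \<comment> \<open>If \<open>k\<close> is at least \<open>N\<close> and \<open>i\<close> at most
    \<open>L\<close>, their difference exceeds \<open>N0\<close>, where \<open>F\<close> has become
    \<open>C\<close>. The factor 3 in \<open>M\<close> leaves a middle third from \<open>N\<close>
    to \<open>M - N\<close> on which both pieces equal \<open>C\<close>.\<close>
  define N where "N = Suc (N0 + L)"
  define M where "M = 3 * N"
  have "\<exists>F. toeplitz (L + (M - L)) F \<and> (\<forall>i\<le>L. F i = f i) \<and>
    (\<forall>i\<le>L + (M - L). F i \<le> C \<and> min C (\<delta> * real i) \<le> F i)"
    by (rule toeplitz_extend[OF f C(3,2)]) (use low in \<open>auto simp: min_def intro: order_trans\<close>)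
  moreover have "L + (M - L) = M" by (simp add: M_def N_def)
  ultimately obtain F where F: "toeplitz M F" "\<And>i. i \<le> L \<Longrightarrow> F i = f i"
      "\<And>i. i \<le> M \<Longrightarrow> F i \<le> C" "\<And>i. i \<le> M \<Longrightarrow> min C (\<delta> * real i) \<le> F i"
    by auto
  have FC: "F n = C" if "N0 \<le> n" "n \<le> M" for n
  proof -
    have "\<delta> * real N0 \<le> \<delta> * real n" using that \<delta> by simp
    then show ?thesis using F(3,4)[of n] that N0 by (auto simp: min_def split: if_splits)
  qed
  have F0: "0 \<le> F n" if "n \<le> M" for n
    using F(1) that unfolding toeplitz_def by (cases "n = 0") (auto intro: less_imp_le)
  have LM: "L < N" "L < M" "N < M" by (auto simp: M_def N_def)
  define A where "A k = insert C ((\<lambda>i. g i + F (ndist k i)) ` {..L})" for k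
  define G where "G k = Min (A k)" for k
  have fin: "finite (A k)" "A k \<noteq> {}" for k by (auto simp: A_def)
  have G_le: "G k \<le> C" "\<And>i. i \<le> L \<Longrightarrow> G k \<le> g i + F (ndist k i)" for k
    unfolding G_def by (rule Min_le[OF fin(1)], force simp: A_def)+
  have "G k \<in> A k" for k
    unfolding G_def using fin by (rule Min_in)
  then have G_cases: "G k = C \<or> (\<exists>i\<le>L. G k = g i + F (ndist k i))" for k
    unfolding A_def by auto
  have G_pos: "0 < G k" if "k \<le> M" for k
    using G_cases[of k]
  proof
    assume "\<exists>i\<le>L. G k = g i + F (ndist k i)"
    then obtain i where "i \<le> L" "G k = g i + F (ndist k i)" by blast
    then show ?thesis
      using gpos[of i] F0[of "ndist k i"] ndist_le[of k M i] that LM by auto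
  qed (use C in simp)
  have Ftri: "F (ndist i k) \<le> F (ndist i j) + F (ndist j k)" if "i \<le> M" "j \<le> M" "k \<le> M" for i j k
    by (rule toeplitz_triangle[OF F(1)]) (use that in \<open>auto intro: ndist_le\<close>)
  have G_lip: "G k \<le> G l + F (ndist k l)" if "k \<le> M" "l \<le> M" for k l
    using G_cases[of l]
  proof
    assume "G l = C"
    then show ?thesis using G_le(1)[of k] F0[of "ndist k l"] ndist_le that by auto
  next
    assume "\<exists>i\<le>L. G l = g i + F (ndist l i)"
    then obtain i where i: "i \<le> L" "G l = g i + F (ndist l i)" by blast
    then show ?thesis
      using G_le(2)[of i k] Ftri[of k l i] that LM by auto
  qed
  \<comment> \<open>A value \<open>C\<close> of \<open>G\<close> bounds \<open>F\<close> by itself.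
    Otherwise both minima are attained at old points \<open>i\<close> and \<open>j\<close>, and the
    path from \<open>k\<close> via \<open>i\<close> and \<open>j\<close> to \<open>l\<close> is
    estimated, using \<open>g2\<close> between \<open>i\<close> and \<open>j\<close>.\<close>
  have G_kat: "F (ndist k l) \<le> G k + G l" if kl: "k \<le> M" "l \<le> M" for k l
  proof (cases "G k = C \<or> G l = C")
    case True
    then show ?thesis
      using G_pos[OF kl(1)] G_pos[OF kl(2)] F(3)[OF ndist_le[OF kl]] by auto
  next
    case False
    then obtain i j where ij: "i \<le> L" "G k = g i + F (ndist k i)" "j \<le> L" "G l = g j + F (ndist l j)"
      using G_cases by blast
    then have "F (ndist i j) \<le> g i + g j"
      using g2[of i j] F(2)[of "ndist i j"] ndist_le by simp
    moreover have "F (ndist k l) \<le> F (ndist k i) + F (ndist i l)" "F (ndist i l) \<le> F (ndist i j) + F (ndist j l)"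
      using kl ij LM by (auto intro!: Ftri)
    ultimately show ?thesis
      using ij by (simp add: ndist_commute[of j l])
  qed
  have G_g: "G k = g k" if "k \<le> L" for k
  proof (rule antisym)
    show "G k \<le> g k"
      using G_le(2)[OF that, of k] F(1) by (simp add: toeplitz_def)
    show "g k \<le> G k"
      using G_cases[of k]
    proof
      assume "\<exists>i\<le>L. G k = g i + F (ndist k i)"
      then show ?thesis
        using g1 that F(2) ndist_le by fastforce
    qed (use gC that in auto)
  qed
  have G_C: "G k = C" if "N \<le> k" "k \<le> M" for k
    using G_cases[of k]
  proof
    assume "\<exists>i\<le>L. G k = g i + F (ndist k i)"
    then obtain i where i: "i \<le> L" "G k = g i + F (ndist k i)" by blast
    then have "F (ndist k i) = C"
      by (intro FC) (use that in \<open>auto simp: N_def ndist_def\<close>)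
    then show ?thesis
      using i gpos[of i] G_le(1)[of k] by simp
  qed
  \<comment> \<open>The new point sits at index \<open>M\<close>, so a difference \<open>n\<close>
    in the tail is the one between \<open>M\<close> and the old index \<open>M - n\<close>, to which
    \<open>G\<close> assigns a distance.\<close>
  define f' where "f' n = (if n < N then F n else G (M - n))" for n
  have hG: "f' n = G (M - n)" if "N \<le> n" for n
    using that by (simp add: f'_def)
  have hC: "f' n = C" if "N \<le> n" "n \<le> M - N" for n
    using that G_C[of "M - n"] by (simp add: f'_def)
  have hF: "f' n = F n" if "n \<le> M - N" for n
    using that hC[of n] FC[of n] by (auto simp: f'_def N_def)
  have "toeplitz M f'"
    unfolding toeplitz_def
  proof (intro conjI allI impI)
    show "f' 0 = 0" using F(1) by (simp add: hF toeplitz_def)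
    show "0 < f' i" if "0 < i \<and> i \<le> M" for i
      using that F(1) G_pos[of "M - i"] by (auto simp: f'_def toeplitz_def)
    fix a b assume ab: "a + b \<le> M"
    have "f' (a + b) \<le> f' a + f' b \<and> f' a \<le> f' b + f' (a + b)"
    proof -
      \<comment> \<open>Up to \<open>M - N\<close> everything is \<open>F\<close>. Beyond it, if one
        summand is below \<open>N\<close>, the inequality concerns a triangle formed by the new
        point and two others, settled by \<open>G_lip\<close> and \<open>G_kat\<close>. If neither
        is, both lie in the middle range with value \<open>C\<close>, and \<open>f' (a + b)\<close>
        is between 0 and \<open>C\<close>.\<close>
      consider "a + b \<le> M - N" | "a < N" "M - N < a + b" | "b < N" "M - N < a + b"
        | "N \<le> a" "N \<le> b" "M - N < a + b" by linarith
      then show ?thesis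
      proof cases
        case 1
        then show ?thesis using F(1) hF[of a] hF[of b] hF[of "a + b"] ab by (auto simp: toeplitz_def)
      next
        case 2
        then have 3: "f' b = G (M - b)" "f' (a + b) = G (M - (a + b))" "f' a = F a"
          by (auto intro!: hG simp: M_def f'_def)
        have "ndist (M - (a + b)) (M - b) = a"
          using ab by (auto simp: ndist_def)
        then show ?thesis
          using G_lip[of "M - (a + b)" "M - b"] G_lip[of "M - b" "M - (a + b)"]
            G_kat[of "M - (a + b)" "M - b"] 3 by (simp add: ndist_commute)
      next
        case 3
        then have 4: "f' a = G (M - a)" "f' (a + b) = G (M - (a + b))" "f' b = F b"
          by (auto intro!: hG simp: M_def f'_def)
        have "ndist (M - (a + b)) (M - a) = b"
          using ab by (auto simp: ndist_def)
        then show ?thesis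
          using G_lip[of "M - (a + b)" "M - a"] G_lip[of "M - a" "M - (a + b)"]
            G_kat[of "M - (a + b)" "M - a"] 4 by (simp add: ndist_commute)
      next
        case 4
        then have "f' a = C" "f' b = C" "f' (a + b) = G (M - (a + b))"
          using ab by (auto intro!: hG hC)
        then show ?thesis
          using G_le(1) G_pos[of "M - (a + b)"] C(2) by (smt (verit) diff_le_self)
      qed
    qed
    then show "f' (a + b) \<le> f' a + f' b" "f' a \<le> f' b + f' (a + b)" by auto
  qed
  moreover have "f' i = f i" "f' (M - i) = g i" if "i \<le> L" for i
  proof -
    show "f' i = f i" using that LM F(2) by (simp add: f'_def)
    have "N \<le> M - i" "i \<le> M" using that by (auto simp: M_def N_def)
    then show "f' (M - i) = g i" using hG[of "M - i"] G_g[OF that] by simp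
  qed
  ultimately show ?thesis using LM(2) by blast
qed

section \<open>Realising finite metric spaces in the Urysohn space\<close>

lemma finite_polish_metric:
  assumes "finite (mspace Y)"
  shows "polish_metric Y"
proof -
  interpret Metric_space "mspace Y" "mdist Y" by simp
  have "compact_space mtopology"
    using assms by (simp add: compact_space_def finite_imp_compactin)
  then have "mcomplete"
    by (rule compact_space_imp_mcomplete)
  moreover have "separable_space mtopology"
    unfolding separable_space_def
    by (rule exI[of _ "mspace Y"]) (use assms closure_of_topspace[of mtopology] in \<open>auto simp: countable_finite\<close>)
  ultimately show ?thesis
    by (simp add: polish_metric_def mtopology_of_def)
qed

text \<open>Universality provides a copy of all of \<open>S\<close> somewhere in \<open>U\<close>;
  homogeneity then moves the copy of \<open>T\<close> onto the prescribed points and carries the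
  rest along.\<close>

lemma urysohn_finite_extension:
  fixes x :: "'b \<Rightarrow> 'a"
  assumes U: "urysohn_space U" and S: "finite S" "T \<subseteq> S" and e: "Metric_space S e"
    and x: "x ` T \<subseteq> mspace U" "\<And>i j. i \<in> T \<Longrightarrow> j \<in> T \<Longrightarrow> mdist U (x i) (x j) = e i j"
  shows "\<exists>y. (\<forall>i\<in>T. y i = x i) \<and> y ` S \<subseteq> mspace U \<and>
    (\<forall>i\<in>S. \<forall>j\<in>S. mdist U (y i) (y j) = e i j)"
proof -
  define Y where "Y = metric (S, e)"
  have Y: "mspace Y = S" "mdist Y = e"
    using e by (simp_all add: Y_def Metric_space.mspace_metric Metric_space.mdist_metric)
  interpret Metric_space S e by (rule e)
  obtain F where F: "isometric_embedding Y U F"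
    using universal_embeds[of U Y] finite_polish_metric[of Y] S U by (auto simp: urysohn_space_def Y)
  then have FU: "\<And>i. i \<in> S \<Longrightarrow> F i \<in> mspace U"
    and Fd: "\<And>i j. i \<in> S \<Longrightarrow> j \<in> S \<Longrightarrow> mdist U (F i) (F j) = e i j"
    by (auto simp: isometric_embedding_def Y)
  have inj: "inj_on F S"
    by (metis FU Fd inj_onI zero mdist_zero)
  then have injT: "inj_on F T" using S(2) inj_on_subset by blast
  let ?h = "x \<circ> inv_into T F"
  have FT: "F ` T \<subseteq> mspace U" using FU S(2) by blast
  have h: "?h (F i) = x i" if "i \<in> T" for i
    using injT that by simp
  have "isometry (submetric U (F ` T)) (submetric U (x ` T)) ?h"
    unfolding isometry_def isometric_embedding_def
  proof (intro conjI ballI)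
    have *: "mspace (submetric U (F ` T)) = F ` T" "mspace (submetric U (x ` T)) = x ` T"
      using FT x(1) by auto
    show "?h \<in> mspace (submetric U (F ` T)) \<rightarrow> mspace (submetric U (x ` T))"
      unfolding * using injT by auto
    show "?h ` mspace (submetric U (F ` T)) = mspace (submetric U (x ` T))"
      unfolding * using h by (force simp: image_iff)
    fix a b assume "a \<in> mspace (submetric U (F ` T))" "b \<in> mspace (submetric U (F ` T))"
    then obtain i j where "i \<in> T" "j \<in> T" "a = F i" "b = F j" unfolding * by blast
    then show "mdist (submetric U (x ` T)) (?h a) (?h b) = mdist (submetric U (F ` T)) a b"
      using h[of i] h[of j] x(2)[of i j] Fd[of i j] S(2) by (simp add: subsetD)
  qed
  moreover have "finite T" using S finite_subset by blast
  ultimately obtain g where g: "g \<in> carrier (Aut U)" "\<And>z. z \<in> F ` T \<Longrightarrow> g z = ?h z"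
    using U FT x(1) unfolding urysohn_space_def metric_homogeneous_def by (metis finite_imageI)
  have gi: "g z \<in> mspace U" "\<And>w. w \<in> mspace U \<Longrightarrow> mdist U (g z) (g w) = mdist U z w" if "z \<in> mspace U" for z
    using g(1) that by (auto simp: Aut_def isometry_def isometric_embedding_def)
  show ?thesis
  proof (intro exI[of _ "g \<circ> F"] conjI ballI)
    show "(g \<circ> F) i = x i" if "i \<in> T" for i using g(2) h that by auto
    show "(g \<circ> F) ` S \<subseteq> mspace U" using gi(1) FU by auto
    show "mdist U ((g \<circ> F) i) ((g \<circ> F) j) = e i j" if "i \<in> S" "j \<in> S" for i j
      using gi(2) FU Fd that by simp
  qed
qed

lemma urysohn_toeplitz_extension:
  assumes U: "urysohn_space U" and f: "toeplitz M f" and T: "T \<subseteq> {..M}"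
    and x: "x ` T \<subseteq> mspace U" "\<And>i j. i \<in> T \<Longrightarrow> j \<in> T \<Longrightarrow> mdist U (x i) (x j) = f (ndist i j)"
  shows "\<exists>y. (\<forall>i\<in>T. y i = x i) \<and> y ` {..M} \<subseteq> mspace U \<and>
    (\<forall>i\<le>M. \<forall>j\<le>M. mdist U (y i) (y j) = f (ndist i j))"
proof -
  have "\<exists>y. (\<forall>i\<in>T. y i = x i) \<and> y ` {..M} \<subseteq> mspace U \<and>
    (\<forall>i\<in>{..M}. \<forall>j\<in>{..M}. mdist U (y i) (y j) = (if i \<le> M \<and> j \<le> M then f (ndist i j) else 0))"
  proof (rule urysohn_finite_extension[OF U _ T toeplitz_Metric_space[OF f] x(1)])
    show "mdist U (x i) (x j) = (if i \<le> M \<and> j \<le> M then f (ndist i j) else 0)" if "i \<in> T" "j \<in> T" for i j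
      using x(2)[OF that] that T by auto
  qed simp
  then show ?thesis by auto
qed

section \<open>Construction of a dense stationary sequence\<close>

definition stationary :: "'a metric \<Rightarrow> nat \<Rightarrow> (nat \<Rightarrow> 'a) \<Rightarrow> bool" where
  "stationary U L x \<longleftrightarrow> x ` {..L} \<subseteq> mspace U \<and>
     (\<exists>f. toeplitz L f \<and> (\<forall>i\<le>L. \<forall>j\<le>L. mdist U (x i) (x j) = f (ndist i j)))"

lemma stationary_extend:
  assumes U: "urysohn_space U" and st: "stationary U L x" and u: "u \<in> mspace U"
  shows "\<exists>M y. stationary U M y \<and> L < M \<and> (\<forall>i\<le>L. y i = x i) \<and> u \<in> y ` {..M}"
proof -
  interpret Metric_space "mspace U" "mdist U" by simp
  obtain f where f: "toeplitz L f" "\<And>i j. i \<le> L \<Longrightarrow> j \<le> L \<Longrightarrow> mdist U (x i) (x j) = f (ndist i j)"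
    using st by (auto simp: stationary_def)
  have xU: "x i \<in> mspace U" if "i \<le> L" for i
    using st that by (auto simp: stationary_def)
  show ?thesis
  proof (cases "u \<in> x ` {..L}")
    \<comment> \<open>Here one of the prescribed distances would be 0, which
      \<open>toeplitz_realize\<close> excludes. The sequence is still lengthened by one term, so
      that the stages exhaust all indices.\<close>
    case True
    obtain C \<delta> where "0 < C" "\<And>i. i \<le> L \<Longrightarrow> f i \<le> C" "\<And>i. i \<le> L \<Longrightarrow> \<delta> * real i \<le> f i"
      using toeplitz_bounds[OF f(1), of 0] by blast
    then obtain m where m: "toeplitz (Suc L) (f(Suc L := m))"
      using toeplitz_Suc[OF f(1), of C \<delta>] by (metis min.coboundedI2)
    have "\<exists>y. (\<forall>i\<in>{..L}. y i = x i) \<and> y ` {..Suc L} \<subseteq> mspace U \<and>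
      (\<forall>i\<le>Suc L. \<forall>j\<le>Suc L. mdist U (y i) (y j) = (f(Suc L := m)) (ndist i j))"
    proof (rule urysohn_toeplitz_extension[OF U m])
      show "x ` {..L} \<subseteq> mspace U" using xU by blast
      show "mdist U (x i) (x j) = (f(Suc L := m)) (ndist i j)" if "i \<in> {..L}" "j \<in> {..L}" for i j
        using f(2)[of i j] ndist_le[of i L j] that by auto
    qed auto
    then obtain y where y0: "\<forall>i\<in>{..L}. y i = x i" and y1: "y ` {..Suc L} \<subseteq> mspace U"
      "\<forall>i\<le>Suc L. \<forall>j\<le>Suc L. mdist U (y i) (y j) = (f(Suc L := m)) (ndist i j)"
      by blast
    have "\<forall>i\<le>L. y i = x i" using y0 by simp
    moreover have "stationary U (Suc L) y"
      unfolding stationary_def using m y1 by (intro conjI exI[of _ "f(Suc L := m)"])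
    ultimately have y: "\<forall>i\<le>L. y i = x i" "stationary U (Suc L) y" by simp_all
    moreover obtain i where "i \<le> L" "u = x i" using True by blast
    ultimately have "u \<in> y ` {..Suc L}" by (auto intro!: image_eqI[of _ _ i])
    then show ?thesis using y by blast
  next
    case False
    define g where "g i = mdist U u (x i)" for i
    have "\<exists>M f'. L < M \<and> toeplitz M f' \<and> (\<forall>i\<le>L. f' i = f i \<and> f' (M - i) = g i)"
    proof (rule toeplitz_realize[OF f(1)])
      show "0 < g i" if "i \<le> L" for i
        using False u xU that by (auto simp: g_def)
      fix i j assume "i \<le> L" "j \<le> L"
      then show "g i \<le> g j + f (ndist i j)" "f (ndist i j) \<le> g i + g j"
        using f(2)[of i j] triangle[of u "x j" "x i"] triangle[of "x i" u "x j"] u xU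
        by (auto simp: g_def commute)
    qed
    then obtain M f' where M: "L < M" "toeplitz M f'" "\<And>i. i \<le> L \<Longrightarrow> f' i = f i"
      "\<And>i. i \<le> L \<Longrightarrow> f' (M - i) = g i" by blast
    have "\<exists>y. (\<forall>i\<in>insert M {..L}. y i = (x(M := u)) i) \<and> y ` {..M} \<subseteq> mspace U \<and>
      (\<forall>i\<le>M. \<forall>j\<le>M. mdist U (y i) (y j) = f' (ndist i j))"
    proof (rule urysohn_toeplitz_extension[OF U M(2)])
      show "(x(M := u)) ` insert M {..L} \<subseteq> mspace U" using xU u by auto
      have *: "mdist U u (x i) = f' (ndist M i)" if "i \<le> L" for i
      proof -
        have "ndist M i = M - i" using that M(1) by (simp add: ndist_def)
        then show ?thesis using M(4) that by (simp add: g_def)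
      qed
      have f'0: "f' 0 = 0" using M(2) by (simp add: toeplitz_def)
      show "mdist U ((x(M := u)) i) ((x(M := u)) j) = f' (ndist i j)"
        if "i \<in> insert M {..L}" "j \<in> insert M {..L}" for i j
      proof -
        consider "i = M" "j = M" | "i = M" "j \<le> L" | "i \<le> L" "j = M" | "i \<le> L" "j \<le> L"
          using \<open>i \<in> _\<close> \<open>j \<in> _\<close> by auto
        then show ?thesis
        proof cases
          case 1
          then show ?thesis using u f'0 by simp
        next
          case 2
          then show ?thesis using *[of j] M(1) by simp
        next
          case 3
          then show ?thesis using *[of i] M(1) by (simp add: commute[of "x i" u] ndist_commute[of i M])
        next
          case 4
          then show ?thesis using f(2)[of i j] M(1,3) ndist_le[of i L j] by simp
        qed
      qed
    qed (use M(1) in auto)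
    then obtain y where y: "\<And>i. i \<in> insert M {..L} \<Longrightarrow> y i = (x(M := u)) i" "stationary U M y"
      using M(2) unfolding stationary_def by metis
    then have "y M = u" "\<forall>i\<le>L. y i = x i"
      using M(1) by auto
    then show ?thesis using y(2) M(1) by blast
  qed
qed

lemma urysohn_nonempty:
  assumes "urysohn_space U"
  shows "\<exists>z. z \<in> mspace U"
proof -
  have "toeplitz 0 (\<lambda>_. 0)" by (auto simp: toeplitz_def)
  from urysohn_toeplitz_extension[OF assms this, of "{}" undefined] show ?thesis
    by auto
qed

text \<open>A one-point space is extended to a two-point space of diameter \<open>r\<close>. Hence
  \<open>U\<close> has no isolated points, so a dense sequence stays dense without its first
  term.\<close>

lemma urysohn_perfect:
  assumes U: "urysohn_space U" and z: "z \<in> mspace U" and r: "0 < r"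
  shows "\<exists>w\<in>mspace U. mdist U z w = r"
proof -
  interpret Metric_space "mspace U" "mdist U" by simp
  let ?f = "\<lambda>n::nat. if n = 0 then 0 else r"
  have "toeplitz 1 ?f" using r by (auto simp: toeplitz_def)
  from urysohn_toeplitz_extension[OF U this, of "{0}" "\<lambda>_. z"] z
  obtain y where y: "y 0 = z" "y ` {..1} \<subseteq> mspace U" "\<forall>i\<le>1. \<forall>j\<le>1. mdist U (y i) (y j) = ?f (ndist i j)"
    by auto
  then have "y 1 \<in> mspace U" "mdist U z (y 1) = r"
    by auto
  then show ?thesis by blast
qed

lemma dense_in_metric_iff:
  "dense_in_metric U S \<longleftrightarrow> S \<subseteq> mspace U \<and> (\<forall>z\<in>mspace U. \<forall>r>0. \<exists>s\<in>S. mdist U z s < r)"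
proof -
  interpret Metric_space "mspace U" "mdist U" by simp
  have "S \<subseteq> mspace U \<Longrightarrow> mtopology closure_of S = {z \<in> mspace U. \<forall>r>0. \<exists>s\<in>S. mdist U z s < r}"
    unfolding metric_closure_of by fastforce
  then show ?thesis
    unfolding dense_in_metric_def mtopology_of_def by blast
qed

lemma urysohn_stationary_sequence:
  assumes U: "urysohn_space U"
  obtains z :: "nat \<Rightarrow> 'a" where "dense_in_metric U (range z)"
    "\<And>i j. mdist U (z (Suc i)) (z (Suc j)) = mdist U (z i) (z j)"
proof -
  interpret Metric_space "mspace U" "mdist U" by simp
  obtain D where D: "countable D" "dense_in_metric U D"
    using U by (auto simp: urysohn_space_def polish_metric_def separable_space_def dense_in_metric_def mtopology_of_def)
  have "D \<noteq> {}"
    using urysohn_nonempty[OF U] D(2) unfolding dense_in_metric_iff by (metis equals0D zero_less_one)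
  then obtain u :: "nat \<Rightarrow> 'a" where u: "range u = D"
    using D(1) by (metis range_from_nat_into)
  have uU: "u n \<in> mspace U" for n
    using u D(2) by (auto simp: dense_in_metric_def)
  \<comment> \<open>A stage is a pair of a last index and a sequence of which only the terms up to
    that index count; stage \<open>Suc n\<close> prolongs stage \<open>n\<close> and visits
    \<open>u n\<close>.\<close>
  have "\<exists>s. \<forall>n. stationary U (fst (s n)) (snd (s n)) \<and>
     (fst (s n) < fst (s (Suc n)) \<and> (\<forall>i\<le>fst (s n). snd (s (Suc n)) i = snd (s n) i) \<and>
      u n \<in> snd (s (Suc n)) ` {..fst (s (Suc n))})"
  proof (rule dependent_nat_choice)
    have "toeplitz 0 (\<lambda>_. 0)" by (auto simp: toeplitz_def)
    then have "stationary U 0 u"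
      unfolding stationary_def using uU by (auto intro!: exI[of _ "\<lambda>_. 0"])
    then show "\<exists>s. stationary U (fst s) (snd s)" by force
    show "\<exists>t. stationary U (fst t) (snd t) \<and> fst s < fst t \<and> (\<forall>i\<le>fst s. snd t i = snd s i) \<and>
      u n \<in> snd t ` {..fst t}" if "stationary U (fst s) (snd s)" for s n
      using stationary_extend[OF U that uU[of n]] by (metis fst_conv snd_conv)
  qed
  then obtain s where s: "\<And>n. stationary U (fst (s n)) (snd (s n))" "\<And>n. fst (s n) < fst (s (Suc n))"
     "\<And>n i. i \<le> fst (s n) \<Longrightarrow> snd (s (Suc n)) i = snd (s n) i"
     "\<And>n. u n \<in> snd (s (Suc n)) ` {..fst (s (Suc n))}"
    by blast
  define L where "L n = fst (s n)" for n
  define x where "x n = snd (s n)" for n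
  have mono: "strict_mono L" using s(2) by (simp add: strict_mono_Suc_iff L_def)
  have nL: "n \<le> L n" for n using mono by (rule strict_mono_imp_increasing)
  have agree: "x n i = x m i" if "m \<le> n" "i \<le> L m" for m n i
    using that
  proof (induction n rule: dec_induct)
    case (step k)
    then have "i \<le> L k" using mono by (meson le_trans monoD strict_mono_mono)
    then show ?case using step s(3)[of i k] by (simp add: x_def L_def)
  qed auto
  \<comment> \<open>The diagonal is the common limit of the stages: since \<open>n\<close> is at
    most \<open>L n\<close>, the term with index \<open>n\<close> is already final at stage
    \<open>n\<close>.\<close>
  define z where "z n = x n n" for n
  have zx: "z i = x n i" if "i \<le> L n" for i n
    using that agree[of i n i] agree[of n i i] nL[of i] unfolding z_def by (metis nat_le_linear)
  show thesis
  proof (rule that)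
    have "range z \<subseteq> mspace U"
    proof -
      have "x n ` {..L n} \<subseteq> mspace U" for n
        using s(1)[of n] by (simp add: stationary_def x_def L_def)
      then show ?thesis using nL by (auto simp: z_def)
    qed
    moreover have "D \<subseteq> range z"
    proof
      fix v assume "v \<in> D"
      then obtain n where "v = u n" using u by blast
      then obtain i where "i \<le> L (Suc n)" "v = x (Suc n) i"
        using s(4)[of n] by (auto simp: x_def L_def)
      then show "v \<in> range z" using zx by (metis rangeI)
    qed
    ultimately show "dense_in_metric U (range z)"
      using D(2) unfolding dense_in_metric_iff by blast
    fix i j
    obtain n where n: "Suc i \<le> L n" "Suc j \<le> L n"
      using nL[of "Suc (i + j)"] by (metis Suc_le_mono le_add1 le_add2 le_trans)
    obtain f where "\<And>i j. i \<le> L n \<Longrightarrow> j \<le> L n \<Longrightarrow> mdist U (x n i) (x n j) = f (ndist i j)"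
      using s(1)[of n] by (auto simp: stationary_def L_def x_def)
    then show "mdist U (z (Suc i)) (z (Suc j)) = mdist U (z i) (z j)"
      using n by (simp add: zx[of _ n])
  qed
qed

section \<open>Extending isometries from dense sequences to the whole space\<close>

text \<open>If \<open>p (a k)\<close> converges to \<open>z\<close>, then \<open>q (a k)\<close> is
  Cauchy because mutual distances agree. Its limit \<open>w\<close> is the image of
  \<open>z\<close>, recorded through its distances to the \<open>q n\<close>, which pass to the
  limit.\<close>

lemma dense_isometry_point:
  assumes U: "polish_metric U" and p: "dense_in_metric U (range p)" and q: "range q \<subseteq> mspace U"
    and pq: "\<And>m n. mdist U (q m) (q n) = mdist U (p m) (p n)" and z: "z \<in> mspace U"
  shows "\<exists>w\<in>mspace U. \<forall>n. mdist U w (q n) = mdist U z (p (n::nat))"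
proof -
  interpret Metric_space "mspace U" "mdist U" by simp
  have pU: "p n \<in> mspace U" for n using p by (auto simp: dense_in_metric_def)
  have qU: "q n \<in> mspace U" for n using q by auto
  have "\<forall>k. \<exists>n. mdist U z (p n) < inverse (real (Suc k))"
    using p z unfolding dense_in_metric_iff by (metis inverse_positive_iff_positive of_nat_0_less_iff rangeE zero_less_Suc)
  then obtain a where a: "\<And>k. mdist U z (p (a k)) < inverse (real (Suc k))" by metis
  have a0: "(\<lambda>k. mdist U z (p (a k))) \<longlonglongrightarrow> 0"
    by (rule tendsto_sandwich[OF _ _ tendsto_const LIMSEQ_inverse_real_of_nat])
      (use a in \<open>auto intro!: always_eventually less_imp_le simp del: of_nat_Suc\<close>)
  have "MCauchy (\<lambda>k. q (a k))"
    unfolding MCauchy_def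
  proof (intro conjI allI impI)
    show "range (\<lambda>k. q (a k)) \<subseteq> mspace U" using qU by auto
    fix r :: real assume "0 < r"
    then obtain N where N: "\<And>k. N \<le> k \<Longrightarrow> mdist U z (p (a k)) < r / 2"
      using order_tendstoD(2)[OF a0, of "r/2"] by (auto simp: eventually_sequentially)
    show "\<exists>N. \<forall>n n'. N \<le> n \<longrightarrow> N \<le> n' \<longrightarrow> mdist U (q (a n)) (q (a n')) < r"
    proof (intro exI[of _ N] allI impI)
      fix n n' assume "N \<le> n" "N \<le> n'"
      then show "mdist U (q (a n)) (q (a n')) < r"
        using N[of n] N[of n'] triangle[of "p (a n)" z "p (a n')"] pU z
        by (simp add: pq commute[of _ z])
    qed
  qed
  then obtain w where w: "limitin mtopology (\<lambda>k. q (a k)) w sequentially"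
    using U by (auto simp: polish_metric_def mcomplete_def)
  then have wU: "w \<in> mspace U" by (simp add: limitin_mspace)
  have w0: "(\<lambda>k. mdist U (q (a k)) w) \<longlonglongrightarrow> 0"
    using w by (simp add: limitin_metric_dist_null)
  have "mdist U w (q n) = mdist U z (p n)" for n
  proof -
    have "\<bar>mdist U w (q n) - mdist U z (p n)\<bar> \<le> mdist U (q (a k)) w + mdist U z (p (a k))" for k
      using triangle[of w "q (a k)" "q n"] triangle[of "q (a k)" w "q n"]
        triangle[of z "p (a k)" "p n"] triangle[of "p (a k)" z "p n"] wU z pU qU
        pq[of "a k" n] commute[of w "q (a k)"] commute[of z "p (a k)"] by simp
    then have "\<bar>mdist U w (q n) - mdist U z (p n)\<bar> \<le> 0 + 0"
      by (intro LIMSEQ_le_const[OF tendsto_add[OF w0 a0]]) auto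
    then show ?thesis by simp
  qed
  then show ?thesis using wU by blast
qed

text \<open>Take \<open>p n\<close> close to \<open>z'\<close>; then \<open>q n\<close> is equally
  close to \<open>w'\<close>. Both distances in the claim differ from the common value of
  \<open>mdist U w (q n)\<close> and \<open>mdist U z (p n)\<close> by at most
  \<open>mdist U z' (p n)\<close>.\<close>

lemma dense_mdist_eqI:
  assumes p: "dense_in_metric U (range p)" and q: "range q \<subseteq> mspace U"
    and z: "z \<in> mspace U" "z' \<in> mspace U" and w: "w \<in> mspace U" "w' \<in> mspace U"
    and "\<And>n. mdist U w (q n) = mdist U z (p n)" "\<And>n. mdist U w' (q n) = mdist U z' (p n)"
  shows "mdist U w w' = mdist U z z'"
proof (rule ccontr)
  interpret Metric_space "mspace U" "mdist U" by simp
  assume "mdist U w w' \<noteq> mdist U z z'"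
  then have "0 < \<bar>mdist U w w' - mdist U z z'\<bar> / 2" by simp
  then obtain n where n: "mdist U z' (p n) < \<bar>mdist U w w' - mdist U z z'\<bar> / 2"
    using p z(2) unfolding dense_in_metric_iff by blast
  have pqU: "p n \<in> mspace U" "q n \<in> mspace U" using p q by (auto simp: dense_in_metric_def)
  have "mdist U w (q n) \<le> mdist U w w' + mdist U w' (q n)" "mdist U w w' \<le> mdist U w (q n) + mdist U w' (q n)"
    using triangle[of w w' "q n"] triangle'[of w "q n" w'] w pqU by (auto simp: commute)
  moreover have "mdist U z (p n) \<le> mdist U z z' + mdist U z' (p n)" "mdist U z z' \<le> mdist U z (p n) + mdist U z' (p n)"
    using triangle[of z z' "p n"] triangle'[of z "p n" z'] z pqU by (auto simp: commute)
  ultimately have "mdist U w w' - mdist U z z' \<le> 2 * mdist U z' (p n)"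
      "mdist U z z' - mdist U w w' \<le> 2 * mdist U z' (p n)"
    using assms(7,8)[of n] by linarith+
  then show False
    using n by (simp add: abs_if split: if_splits)
qed

lemma Aut_iff:
  "g \<in> carrier (Aut U) \<longleftrightarrow> g \<in> Bij (mspace U) \<and>
     (\<forall>x\<in>mspace U. \<forall>y\<in>mspace U. mdist U (g x) (g y) = mdist U x y)"
  by (auto simp: Aut_def isometry_def isometric_embedding_def Bij_def bij_betw_def)

lemma dense_isometry_extends:
  fixes p q :: "nat \<Rightarrow> 'a"
  assumes U: "polish_metric U" and p: "dense_in_metric U (range p)" and q: "dense_in_metric U (range q)"
    and pq: "\<And>m n. mdist U (q m) (q n) = mdist U (p m) (p n)"
  shows "\<exists>g\<in>carrier (Aut U). \<forall>n. g (p n) = q n"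
proof -
  interpret Metric_space "mspace U" "mdist U" by simp
  have pU: "range p \<subseteq> mspace U" and qU: "range q \<subseteq> mspace U"
    using p q by (auto simp: dense_in_metric_def)
  obtain h where h: "\<And>z. z \<in> mspace U \<Longrightarrow> h z \<in> mspace U"
    "\<And>z n. z \<in> mspace U \<Longrightarrow> mdist U (h z) (q n) = mdist U z (p n)"
    using dense_isometry_point[OF U p qU pq] by metis
  have hd: "mdist U (h z) (h z') = mdist U z z'" if "z \<in> mspace U" "z' \<in> mspace U" for z z'
    using dense_mdist_eqI[OF p qU, of z z' "h z" "h z'"] h that by blast
  have "w \<in> h ` mspace U" if w: "w \<in> mspace U" for w
  proof -
    \<comment> \<open>A preimage of \<open>w\<close> comes from exchanging \<open>p\<close> and
      \<open>q\<close>. Then \<open>h z\<close> and \<open>w\<close> have the same distances to all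
      \<open>q n\<close>, so they coincide.\<close>
    obtain z where z: "z \<in> mspace U" "\<And>n. mdist U z (p n) = mdist U w (q n)"
      using dense_isometry_point[OF U q pU pq[symmetric] w] by blast
    have "mdist U (h z) w = mdist U z z"
      by (rule dense_mdist_eqI[OF p qU]) (use z w h in auto)
    then have "h z = w" using z w h(1) by simp
    then show ?thesis using z(1) by blast
  qed
  then have "h ` mspace U = mspace U" using h(1) by auto
  moreover have "inj_on h (mspace U)"
    by (rule inj_onI) (metis hd h(1) zero)
  ultimately have "restrict h (mspace U) \<in> carrier (Aut U)"
    using hd by (auto simp: Aut_iff Bij_def bij_betw_def)
  moreover have "restrict h (mspace U) (p n) = q n" for n
  proof -
    have "p n \<in> mspace U" "q n \<in> mspace U" using pU qU by auto
    then show ?thesis using h(1)[of "p n"] h(2)[of "p n" n] by simp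
  qed
  ultimately show ?thesis by blast
qed

section \<open>Powers of an isometry and their orbits\<close>

lemma Aut_mult_apply:
  assumes "g \<in> carrier (Aut U)" "h \<in> carrier (Aut U)" "x \<in> mspace U"
  shows "(g \<otimes>\<^bsub>Aut U\<^esub> h) x = g (h x)"
  using assms by (simp add: Aut_def BijGroup_def compose_def)

lemma Aut_one_apply: "x \<in> mspace U \<Longrightarrow> \<one>\<^bsub>Aut U\<^esub> x = x"
  by (simp add: Aut_def BijGroup_def)

lemma Aut_mem: "g \<in> carrier (Aut U) \<Longrightarrow> x \<in> mspace U \<Longrightarrow> g x \<in> mspace U"
  using Bij_imp_funcset[of g "mspace U"] by (auto simp: Aut_iff)

lemma Aut_orbit_dense:
  assumes g: "g \<in> carrier (Aut U)" and x: "x \<in> mspace U" and d: "dense_in_metric U (cyclic_orbit U g x)"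
    and y: "y \<in> mspace U"
  shows "dense_in_metric U (cyclic_orbit U g y)"
  unfolding dense_in_metric_iff
proof (intro conjI ballI allI impI)
  interpret Metric_space "mspace U" "mdist U" by simp
  interpret G: group "Aut U" by (rule group_Aut)
  let ?p = "\<lambda>n::int. g [^]\<^bsub>Aut U\<^esub> n"
  have p: "?p n \<in> carrier (Aut U)" for n using g by simp
  show "cyclic_orbit U g y \<subseteq> mspace U"
    using Aut_mem[OF p y] by (auto simp: cyclic_orbit_def)
  fix z and r :: real assume z: "z \<in> mspace U" and "0 < r"
  have near: "\<exists>n. mdist U v (?p n x) < r / 2" if "v \<in> mspace U" for v
    using d that \<open>0 < r\<close> unfolding dense_in_metric_iff cyclic_orbit_def
    by (smt (verit, ccfv_SIG) half_gt_zero mem_Collect_eq)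
  obtain m n where m: "mdist U z (?p m x) < r / 2" and n: "mdist U y (?p n x) < r / 2"
    using near z y by blast
  have "?p m = ?p (m - n) \<otimes>\<^bsub>Aut U\<^esub> ?p n"
    using g by (simp flip: G.int_pow_mult)
  then have "?p m x = ?p (m - n) (?p n x)"
    using Aut_mult_apply[OF p p x] by simp
  moreover have "mdist U (?p (m - n) y) (?p (m - n) (?p n x)) = mdist U y (?p n x)"
    using p[of "m - n"] Aut_mem[OF p x] y by (simp add: Aut_iff)
  ultimately have "mdist U (?p m x) (?p (m - n) y) < r / 2"
    using n by (simp add: commute)
  then have "mdist U z (?p (m - n) y) < r"
    using m triangle[of z "?p m x" "?p (m - n) y"] z Aut_mem[OF p] x y by fastforce
  then show "\<exists>s\<in>cyclic_orbit U g y. mdist U z s < r"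
    by (auto simp: cyclic_orbit_def)
qed

theorem theorem4:
  fixes U :: "'a metric"
  assumes "urysohn_space U"
  shows "(\<exists>g\<in>carrier (Aut U). \<exists>x\<in>mspace U. dense_in_metric U (cyclic_orbit U g x)) \<and>
    (\<forall>g\<in>carrier (Aut U).
       (\<exists>x\<in>mspace U. dense_in_metric U (cyclic_orbit U g x)) \<longrightarrow>
       (\<forall>y\<in>mspace U. dense_in_metric U (cyclic_orbit U g y)))"
proof (rule conjI)
  interpret Metric_space "mspace U" "mdist U" by simp
  interpret G: group "Aut U" by (rule group_Aut)
  obtain z :: "nat \<Rightarrow> 'a" where z: "dense_in_metric U (range z)"
    "\<And>i j. mdist U (z (Suc i)) (z (Suc j)) = mdist U (z i) (z j)"
    using urysohn_stationary_sequence[OF assms] by blast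
  have zU: "z n \<in> mspace U" for n using z(1) by (auto simp: dense_in_metric_def)
  have "dense_in_metric U (range (\<lambda>n. z (Suc n)))"
    unfolding dense_in_metric_iff
  proof (intro conjI ballI allI impI)
    show "range (\<lambda>n. z (Suc n)) \<subseteq> mspace U" using zU by blast
    fix v and r :: real assume v: "v \<in> mspace U" and r: "0 < r"
    have near: "\<exists>n. mdist U w (z n) < t" if "w \<in> mspace U" "0 < t" for w t
      using z(1) that unfolding dense_in_metric_iff by blast
    \<comment> \<open>A point \<open>w\<close> at distance exactly \<open>t\<close> from
      \<open>v\<close> is approximated by \<open>z n\<close> to within \<open>t\<close>, so
      \<open>z n\<close> is within \<open>r\<close> of \<open>v\<close>. The choice of
      \<open>t\<close> excludes \<open>n = 0\<close>: if \<open>v = z 0\<close>, then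
      \<open>z 0\<close> is at distance \<open>t\<close> from \<open>w\<close>; otherwise
      \<open>z 0\<close> is at least \<open>2 * t\<close> away from \<open>v\<close>.\<close>
    define t where "t = (if v = z 0 then r / 2 else min (r / 2) (mdist U v (z 0) / 2))"
    have t: "0 < t" "t \<le> r / 2" using r v zU by (auto simp: t_def)
    obtain w where w: "w \<in> mspace U" "mdist U v w = t"
      using urysohn_perfect[OF assms v t(1)] by blast
    obtain n where n: "mdist U w (z n) < t" using near w t by blast
    have "mdist U v (z n) < 2 * t"
      using n w triangle[of v w "z n"] v zU by fastforce
    moreover have "n \<noteq> 0"
    proof
      assume "n = 0"
      then show False
        using n w v zU calculation by (auto simp: t_def commute split: if_splits)
    qed
    ultimately show "\<exists>s\<in>range (\<lambda>n. z (Suc n)). mdist U v s < r"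
      using t by (cases n) (auto intro!: exI[of _ "n - 1"])
  qed
  then obtain g where g: "g \<in> carrier (Aut U)" "\<And>n. g (z n) = z (Suc n)"
    using dense_isometry_extends[of U z "\<lambda>n. z (Suc n)"] z assms by (auto simp: urysohn_space_def)
  have "(g [^]\<^bsub>Aut U\<^esub> n) (z 0) = z n" for n :: nat
  proof (induction n)
    case 0
    then show ?case using Aut_one_apply[of "z 0" U] zU by simp
  next
    case (Suc n)
    have "g [^]\<^bsub>Aut U\<^esub> Suc n = g \<otimes>\<^bsub>Aut U\<^esub> g [^]\<^bsub>Aut U\<^esub> n"
      using g(1) by (rule G.nat_pow_Suc2)
    then show ?case using Aut_mult_apply[of g U "g [^]\<^bsub>Aut U\<^esub> n" "z 0"] g zU Suc by simp
  qed
  then have "(g [^]\<^bsub>Aut U\<^esub> int n) (z 0) = z n" for n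
    by (simp add: int_pow_int)
  \<comment> \<open>The nonnegative powers of \<open>g\<close> already run through the dense
    sequence.\<close>
  then have "range z \<subseteq> cyclic_orbit U g (z 0)"
    unfolding cyclic_orbit_def by (metis (mono_tags, lifting) image_subsetI mem_Collect_eq)
  moreover have "cyclic_orbit U g (z 0) \<subseteq> mspace U"
    using Aut_mem[of _ U "z 0"] g(1) zU by (auto simp: cyclic_orbit_def)
  ultimately have "dense_in_metric U (cyclic_orbit U g (z 0))"
    using z(1) unfolding dense_in_metric_iff by blast
  then show "\<exists>g\<in>carrier (Aut U). \<exists>x\<in>mspace U. dense_in_metric U (cyclic_orbit U g x)"
    using g(1) zU by blast
qed (intro ballI impI, elim bexE, rule Aut_orbit_dense)

end
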